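(* Let $C_n$ be the cycle of length $n \geq 4$. Then $\mathcal{D}_{\mathrm{lir}}(C_n) = 0$ if $n \equiv 0 \pmod 4$, $\mathcal{D}_{\mathrm{lir}}(C_n) = 1$ if $n \equiv 1 \pmod 4$, and $\mathcal{D}_{\mathrm{lir}}(C_n) = 2$ if $n \equiv 2$ or $3 \pmod 4$.
   Context: A (multi)graph is locally irregular if the two endvertices of every edge have different degrees (degrees in multigraphs count parallel edges with multiplicity). For a graph $G$ and a set $E_d \subseteq E(G)$, $G + E_d$ denotes the multigraph obtained from $G$ by replacing each edge of $E_d$ by two parallel edges. For a connected graph $G$ not isomorphic to $K_2$ or $K_3$, $\mathcal{D}_{\mathrm{lir}}(G)$ is the minimum size of a set $E_d \subseteq E(G)$ such that the edges of $G+E_d$ can be colored with at most two colors so that each color class induces a locally irregular sub(multi)graph and any two parallel edges receive the same color. *)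

theory Defs
  imports Main "HOL-Library.Extended_Nat"
begin

record ('v, 'e) multigraph =
  verts :: "'v set"
  edges :: "'e set"
  ends :: "'e \<Rightarrow> 'v set"

definition finite_multigraph :: "('v, 'e) multigraph \<Rightarrow> bool" where
  "finite_multigraph G \<longleftrightarrow> finite (verts G) \<and> finite (edges G) \<and>
     (\<forall>e\<in>edges G. ends G e \<subseteq> verts G \<and> card (ends G e) = 2)"

definition parallel :: "('v, 'e) multigraph \<Rightarrow> 'e \<Rightarrow> 'e \<Rightarrow> bool" where
  "parallel G e f \<longleftrightarrow> ends G e = ends G f"

definition simple_graph :: "('v, 'e) multigraph \<Rightarrow> bool" where
  "simple_graph G \<longleftrightarrow> finite_multigraph G \<and>
     (\<forall>e\<in>edges G. \<forall>f\<in>edges G. parallel G e f \<longrightarrow> e = f)"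

definition mdegree :: "('v, 'e) multigraph \<Rightarrow> 'v \<Rightarrow> nat" where
  "mdegree G v = card {e \<in> edges G. v \<in> ends G e}"

definition locally_irregular :: "('v, 'e) multigraph \<Rightarrow> bool" where
  "locally_irregular G \<longleftrightarrow>
     (\<forall>e\<in>edges G. \<forall>u\<in>ends G e. \<forall>v\<in>ends G e. u \<noteq> v \<longrightarrow> mdegree G u \<noteq> mdegree G v)"

definition edge_induced :: "('v, 'e) multigraph \<Rightarrow> 'e set \<Rightarrow> ('v, 'e) multigraph" where
  "edge_induced G F = \<lparr>verts = (\<Union>e\<in>F. ends G e), edges = F, ends = ends G\<rparr>"

(* G + D: the edge e of G is kept as (e, False); (e, True) is the second copy of an edge e in D. *)
definition double_edges :: "('v, 'e) multigraph \<Rightarrow> 'e set \<Rightarrow> ('v, 'e \<times> bool) multigraph" where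
  "double_edges G D =
     \<lparr>verts = verts G, edges = edges G \<times> {False} \<union> D \<times> {True}, ends = (\<lambda>e. ends G (fst e))\<rparr>"

(* A colour class may be empty, and the empty multigraph is locally irregular, so this is a
   colouring with at most two colours. *)
definition lir_2_colouring :: "('v, 'e) multigraph \<Rightarrow> ('e \<Rightarrow> nat) \<Rightarrow> bool" where
  "lir_2_colouring H c \<longleftrightarrow>
     (\<forall>e\<in>edges H. c e < 2) \<and>
     (\<forall>i<2. locally_irregular (edge_induced H {e \<in> edges H. c e = i})) \<and>
     (\<forall>e\<in>edges H. \<forall>f\<in>edges H. parallel H e f \<longrightarrow> c e = c f)"

(* Intended for finite simple connected graphs other than K_2 and K_3. The values are extended
   naturals so that the infimum is infinity, not a number, when no suitable D exists (as for K_2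
   and K_3); otherwise it is the minimum of the sizes. *)
definition D_lir :: "('v, 'e) multigraph \<Rightarrow> enat" where
  "D_lir G = Inf {enat (card D) | D. D \<subseteq> edges G \<and> (\<exists>c. lir_2_colouring (double_edges G D) c)}"

definition cycle_graph :: "nat \<Rightarrow> (nat, nat) multigraph" where
  "cycle_graph n = \<lparr>verts = {..<n}, edges = {..<n}, ends = (\<lambda>i. {i, Suc i mod n})\<rparr>"

lemma simple_graph_cycle_graph:
  assumes "n \<ge> 3"
  shows "simple_graph (cycle_graph n)"
proof -
  have next_neq: "i \<noteq> Suc i mod n" if "i < n" for i
    using that assms by (cases "Suc i = n") auto
  have "card {i, Suc i mod n} = 2" if "i < n" for i
    using next_neq[OF that] by simp
  moreover have "Suc i mod n < n" for i
    using assms by simp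
  moreover have "i = j" if "i < n" "j < n" "{i, Suc i mod n} = {j, Suc j mod n}" for i j
    using that assms
    by (cases "Suc i = n"; cases "Suc j = n") (auto simp: doubleton_eq_iff)
  ultimately show ?thesis
    by (simp add: simple_graph_def finite_multigraph_def parallel_def cycle_graph_def)
qed

end

theory Submission
  imports Defs
begin

text \<open>
  An edge \<open>i\<close> of the cycle satisfies the degree condition iff its two neighbouring edges, each
  counted with its multiplicity if it has the colour of \<open>i\<close> and with \<open>0\<close> otherwise, count
  differently. If no neighbour is doubled, this says that the two neighbours have different
  colours. With at most one doubled edge, walking around the cycle in steps of two therefore
  alternates the colours almost everywhere, and closing up forces \<open>n mod 4 \<in> {0, 1}\<close>, and
  \<open>n mod 4 = 0\<close> if nothing is doubled. Conversely, colour \<open>0011 0011 \<dots> 0011\<close>, give the at most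
  three remaining edges the colour \<open>1\<close> as well, and double the first two of them.
\<close>

section \<open>Degrees in the colour classes of a cycle\<close>

definition multiplicity :: "'e set \<Rightarrow> 'e \<Rightarrow> nat" where
  "multiplicity D e = (if e \<in> D then 2 else 1)"

text \<open>What the copies of \<open>e\<close> add to the degree of each endvertex of
  \<open>e\<close> in colour class \<open>k\<close>. The colour type is left open: colours are
  numbers in the construction and truth values in the lower bound.\<close>

definition coloured_multiplicity :: "'e set \<Rightarrow> ('e \<Rightarrow> 'c) \<Rightarrow> 'c \<Rightarrow> 'e \<Rightarrow> nat" where
  "coloured_multiplicity D f k e = (if f e = k then multiplicity D e else 0)"

lemma card_copies:
  assumes "finite J"
  shows "card {e. fst e \<in> J \<and> (snd e \<longrightarrow> fst e \<in> D) \<and> f (fst e) = k} =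
    (\<Sum>j\<in>J. coloured_multiplicity D f k j)"
proof -
  let ?T = "\<lambda>j. {t. (t \<longrightarrow> j \<in> D) \<and> f j = k}"
  have "{e. fst e \<in> J \<and> (snd e \<longrightarrow> fst e \<in> D) \<and> f (fst e) = k} = Sigma J ?T"
    by auto
  moreover have "card (?T j) = coloured_multiplicity D f k j" for j
  proof -
    have "?T j = (if f j = k then if j \<in> D then {False, True} else {False} else {})"
      by auto
    then show ?thesis
      by (simp add: coloured_multiplicity_def multiplicity_def)
  qed
  ultimately show ?thesis
    using assms by simp
qed

lemma Suc_mod_neq:
  assumes "n \<ge> 2" "i < n"
  shows "Suc i mod n \<noteq> i"
  using assms by (cases "Suc i = n") auto

lemma Suc_mod_inj:
  assumes "i < n" "j < n" "Suc i mod n = Suc j mod n"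
  shows "i = j"
  using assms by (cases "Suc i = n"; cases "Suc j = n") auto

text \<open>Only the edges \<open>i\<close> and \<open>Suc i mod n\<close> meet this vertex. Every
  vertex has this form, which avoids subtraction modulo \<open>n\<close>.\<close>

lemma mdegree_cycle_colour_class:
  assumes "n \<ge> 2" "i < n" "D \<subseteq> {..<n}"
    and "\<forall>e\<in>edges (double_edges (cycle_graph n) D). c e = f (fst e)"
  shows "mdegree (edge_induced (double_edges (cycle_graph n) D)
      {e \<in> edges (double_edges (cycle_graph n) D). c e = k}) (Suc i mod n) =
    coloured_multiplicity D f k i + coloured_multiplicity D f k (Suc i mod n)"
proof -
  let ?s = "Suc i mod n" and ?H = "double_edges (cycle_graph n) D"
  have "?s < n"
    using assms by simp
  have edges: "edges ?H = {e. fst e < n \<and> (snd e \<longrightarrow> fst e \<in> D)}"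
    using assms(3) by (auto simp: double_edges_def cycle_graph_def)
  let ?G = "edge_induced ?H {e \<in> edges ?H. c e = k}"
  have "{e \<in> edges ?G. ?s \<in> ends ?H e} =
      {e. fst e \<in> {i, ?s} \<and> (snd e \<longrightarrow> fst e \<in> D) \<and> f (fst e) = k}"
    (is "?L = ?R")
  proof (rule set_eqI)
    fix e :: "nat \<times> bool"
    have ends: "?s \<in> ends ?H e \<longleftrightarrow> fst e = i \<or> fst e = ?s" if "fst e < n"
      using that Suc_mod_inj[OF assms(2) that]
      by (auto simp: double_edges_def cycle_graph_def)
    have L: "e \<in> ?L \<longleftrightarrow> e \<in> edges ?H \<and> c e = k \<and> ?s \<in> ends ?H e"
      by (simp add: edge_induced_def)
    have edge: "e \<in> edges ?H \<longleftrightarrow> fst e < n \<and> (snd e \<longrightarrow> fst e \<in> D)"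
      by (simp add: edges)
    have R: "e \<in> ?R \<longleftrightarrow> (fst e = i \<or> fst e = ?s) \<and> (snd e \<longrightarrow> fst e \<in> D) \<and> f (fst e) = k"
      by simp
    show "e \<in> ?L \<longleftrightarrow> e \<in> ?R"
    proof (cases "fst e < n")
      case True
      then show ?thesis
        unfolding L R ends[OF True] edge using assms(4) edge by metis
    next
      case False
      then have "fst e \<noteq> i" "fst e \<noteq> ?s"
        using assms(2) \<open>?s < n\<close> by metis+
      then show ?thesis
        unfolding L R edge using False by simp
    qed
  qed
  then have "mdegree ?G ?s = card ?R"
    by (simp add: mdegree_def edge_induced_def)
  also have "\<dots> = (\<Sum>j\<in>{i, ?s}. coloured_multiplicity D f k j)"
    by (rule card_copies) simp
  also have "\<dots> = coloured_multiplicity D f k i + coloured_multiplicity D f k ?s"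
    using Suc_mod_neq[OF assms(1,2)] by simp
  finally show ?thesis .
qed

text \<open>The degrees of the two endvertices of edge \<open>i\<close> share the summand of
  \<open>i\<close> itself, so only the contributions of its neighbours \<open>p\<close> and
  \<open>s\<close> are left to compare.\<close>

lemma lir_2_colouring_cycle_iff:
  fixes f :: "nat \<Rightarrow> nat"
  assumes n: "n \<ge> 2" and D: "D \<subseteq> {..<n}"
    and c: "\<forall>e\<in>edges (double_edges (cycle_graph n) D). c e = f (fst e)"
    and f: "\<forall>i<n. f i < 2"
  shows "(\<forall>k<2. locally_irregular (edge_induced (double_edges (cycle_graph n) D)
      {e \<in> edges (double_edges (cycle_graph n) D). c e = k})) \<longleftrightarrow>
    (\<forall>p<n. let i = Suc p mod n; s = Suc i mod n in
      coloured_multiplicity D f (f i) p \<noteq> coloured_multiplicity D f (f i) s)"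
    (is "?L \<longleftrightarrow> ?R")
proof -
  let ?H = "double_edges (cycle_graph n) D"
  let ?F = "\<lambda>k. {e \<in> edges ?H. c e = k}"
  let ?deg = "\<lambda>k. mdegree (edge_induced ?H (?F k))"
  let ?m = "coloured_multiplicity D f"
  have deg: "?deg k (Suc i mod n) = ?m k i + ?m k (Suc i mod n)" if "i < n" for i k
    using mdegree_cycle_colour_class[OF n that D c] .
  have pred: "\<exists>p<n. i = Suc p mod n" if "i < n" for i
    using that by (cases i) (auto intro: exI[of _ "n - 1"] exI[of _ "i - 1"])
  have "?L \<longleftrightarrow> (\<forall>i<n. ?deg (f i) i \<noteq> ?deg (f i) (Suc i mod n))"
  proof (intro iffI allI impI)
    fix i assume L: ?L and i: "i < n"
    have "(i, False) \<in> ?F (f i)"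
      using i c by (auto simp: double_edges_def cycle_graph_def)
    moreover have "locally_irregular (edge_induced ?H (?F (f i)))"
      using L f i by blast
    moreover have "ends (edge_induced ?H (?F (f i))) (i, False) = {i, Suc i mod n}"
      "edges (edge_induced ?H (?F (f i))) = ?F (f i)"
      by (simp_all add: edge_induced_def double_edges_def cycle_graph_def)
    ultimately show "?deg (f i) i \<noteq> ?deg (f i) (Suc i mod n)"
      using Suc_mod_neq[OF n i] unfolding locally_irregular_def
      by (drule_tac bspec[where x = "(i, False)"]) simp_all
  next
    fix k :: nat
    assume R: "\<forall>i<n. ?deg (f i) i \<noteq> ?deg (f i) (Suc i mod n)"
    have "?deg k u \<noteq> ?deg k v"
      if "e \<in> ?F k" "u \<in> ends ?H e" "v \<in> ends ?H e" "u \<noteq> v" for e u v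
    proof -
      have e: "fst e < n" "f (fst e) = k"
        using that(1) c D by (auto simp: double_edges_def cycle_graph_def)
      have "u = fst e \<and> v = Suc (fst e) mod n \<or> v = fst e \<and> u = Suc (fst e) mod n"
        using that by (auto simp: double_edges_def cycle_graph_def)
      then show ?thesis
        using R[rule_format, OF e(1)] e(2) by auto
    qed
    then show "locally_irregular (edge_induced ?H (?F k))"
      unfolding locally_irregular_def by (simp add: edge_induced_def)
  qed
  also have "\<dots> \<longleftrightarrow> ?R"
  proof -
    have s: "Suc p mod n < n" for p
      using n by simp
    \<comment> \<open>The successor map is onto, so each edge is reached from its predecessor
      \<open>p\<close>.\<close>
    have *: "(\<forall>i<n. P i) \<longleftrightarrow> (\<forall>p<n. P (Suc p mod n))" for P
      using pred s by (metis (no_types))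
    have "?deg k (Suc p mod n) \<noteq> ?deg k (Suc (Suc p mod n) mod n) \<longleftrightarrow>
        ?m k p \<noteq> ?m k (Suc (Suc p mod n) mod n)" if "p < n" for p k
      unfolding deg[OF that] deg[OF s] by linarith
    then show ?thesis
      unfolding Let_def by (subst *) blast
  qed
  finally show ?thesis .
qed

section \<open>Upper bound: the colouring in blocks of four\<close>

lemma cycle_colouring_exists:
  assumes "n \<ge> 4"
  defines "m \<equiv> 4 * (n div 4)"
  defines "D \<equiv> {m..<min n (m + 2)}"
  shows "\<exists>c. lir_2_colouring (double_edges (cycle_graph n) D) c"
proof -
  define f :: "nat \<Rightarrow> nat" where "f i = (if i < m \<and> i mod 4 < 2 then 0 else 1)" for i
  have m: "m \<le> n" "n < m + 4" "4 \<le> m" "m mod 4 = 0"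
    using assms(1) by (auto simp: m_def)
  have D: "D \<subseteq> {..<n}"
    by (auto simp: D_def)
  \<comment> \<open>The last block ends in 11 and the leftover edges have colour 1 too.\<close>
  have f1: "f j = 1" if "m \<le> j + 2" for j
  proof -
    have "\<not> j mod 4 < 2" if "j < m"
      using \<open>m \<le> j + 2\<close> that m(3,4) by presburger
    then show ?thesis
      by (auto simp: f_def)
  qed
  have f0: "f 0 = 0" "f 1 = 0"
    using m(3) by (auto simp: f_def)
  have "coloured_multiplicity D f (f i) p \<noteq> coloured_multiplicity D f (f i) s"
    if "p < n" "i = Suc p mod n" "s = Suc i mod n" for p i s
  proof -
    consider "p + 2 < n" "i = p + 1" "s = p + 2" | "p = n - 2" "i = n - 1" "s = 0"
      | "p = n - 1" "i = 0" "s = 1"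
      using \<open>p < n\<close> \<open>i = _\<close> \<open>s = _\<close> assms(1)
      by (cases "Suc p = n"; cases "Suc (Suc p) = n") auto
    then show ?thesis
    proof cases
      case 1
      \<comment> \<open>Inside the blocks, edges two apart differ in colour. Beyond them all three
        edges have colour 1 and exactly one of \<open>p\<close> and \<open>s\<close> is doubled;
        \<open>n < m + 4\<close> excludes larger \<open>s\<close>.\<close>
      consider "s < m" | "s = m" | "s = m + 1" | "s = m + 2"
        using 1 m by linarith
      then show ?thesis
      proof cases
        case 1
        have "p mod 4 < 2 \<longleftrightarrow> \<not> s mod 4 < 2"
          unfolding \<open>s = p + 2\<close> by presburger
        then have "f p \<noteq> f s"
          using 1 \<open>s = p + 2\<close> by (auto simp: f_def)
        then have "f p = f i \<and> f s \<noteq> f i \<or> f p \<noteq> f i \<and> f s = f i"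
          by (auto simp: f_def split: if_splits)
        then show ?thesis
          by (auto simp: coloured_multiplicity_def multiplicity_def)
      next
        case 2
        have "f p = 1" "f i = 1" "f s = 1"
          using 1 2 by (simp_all add: f1)
        then show ?thesis
          using 1 2 by (auto simp: coloured_multiplicity_def multiplicity_def D_def)
      next
        case 3
        have "f p = 1" "f i = 1" "f s = 1"
          using 1 3 by (simp_all add: f1)
        then show ?thesis
          using 1 3 by (auto simp: coloured_multiplicity_def multiplicity_def D_def)
      next
        case 4
        have "f p = 1" "f i = 1" "f s = 1"
          using 1 4 by (simp_all add: f1)
        then show ?thesis
          using 1 4 by (auto simp: coloured_multiplicity_def multiplicity_def D_def)
      qed
    next
      case 2
      \<comment> \<open>Across the wrap-around the colours read 1, 1, 0 here and 1, 0, 0 in the next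
        case, so exactly one neighbour has the colour of \<open>i\<close>.\<close>
      have "f p = 1" "f i = 1" "f s = 0"
        using 2 m f0 by (simp_all add: f1)
      then show ?thesis
        by (simp add: coloured_multiplicity_def multiplicity_def)
    next
      case 3
      have "f p = 1" "f i = 0" "f s = 0"
        using 3 m f0 by (simp_all add: f1)
      then show ?thesis
        by (simp add: coloured_multiplicity_def multiplicity_def)
    qed
  qed
  then have "\<forall>k<2. locally_irregular (edge_induced (double_edges (cycle_graph n) D)
      {e \<in> edges (double_edges (cycle_graph n) D). f (fst e) = k})"
    using assms(1) D by (subst lir_2_colouring_cycle_iff[where f = f]) (auto simp: f_def Let_def)
  moreover have "f (fst e) = f (fst e')"
    if "e \<in> edges (double_edges (cycle_graph n) D)" "e' \<in> edges (double_edges (cycle_graph n) D)"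
      "parallel (double_edges (cycle_graph n) D) e e'" for e e'
  proof -
    have "parallel (cycle_graph n) (fst e) (fst e')" "fst e \<in> edges (cycle_graph n)"
      "fst e' \<in> edges (cycle_graph n)"
      using that D by (auto simp: parallel_def double_edges_def cycle_graph_def)
    then have "fst e = fst e'"
      using simple_graph_cycle_graph[of n] assms(1) by (auto simp: simple_graph_def)
    then show ?thesis by simp
  qed
  ultimately have "lir_2_colouring (double_edges (cycle_graph n) D) (\<lambda>e. f (fst e))"
    by (auto simp: lir_2_colouring_def f_def)
  then show ?thesis by blast
qed

section \<open>Lower bound: walks in steps of two\<close>

text \<open>The periodic extension lets a walk pass the wrap-around freely. With truth values as
  colours, a change of colour is a negation and parity arguments become propositional.\<close>

lemma cycle_colouring_unrolled:
  assumes "n \<ge> 2" "D \<subseteq> {..<n}" "lir_2_colouring (double_edges (cycle_graph n) D) c"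
  obtains f :: "nat \<Rightarrow> bool" where "\<And>i. f (i mod n) = f i"
    and "\<And>i. coloured_multiplicity D f (f (i + 1)) (i mod n) \<noteq>
           coloured_multiplicity D f (f (i + 1)) ((i + 2) mod n)"
proof -
  let ?H = "double_edges (cycle_graph n) D"
  define g where "g i = c (i, False)" for i
  have c: "c e < 2" "c e = g (fst e)" if "e \<in> edges ?H" for e
  proof -
    have "parallel ?H e (fst e, False)" "(fst e, False) \<in> edges ?H"
      using that assms(2) by (auto simp: parallel_def double_edges_def cycle_graph_def)
    then show "c e < 2" "c e = g (fst e)"
      using that assms(3) by (auto simp: lir_2_colouring_def g_def)
  qed
  have g: "g i < 2" if "i < n" for i
    using c(1)[of "(i, False)"] that by (simp add: g_def double_edges_def cycle_graph_def)
  have *: "coloured_multiplicity D g (g (Suc p mod n)) p \<noteq>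
      coloured_multiplicity D g (g (Suc p mod n)) (Suc (Suc p mod n) mod n)" if "p < n" for p
    using lir_2_colouring_cycle_iff[OF assms(1,2), of c g] c(2) g assms(3) that
    by (auto simp: lir_2_colouring_def Let_def)
  define f where "f i = (g (i mod n) = 0)" for i
  have eq: "coloured_multiplicity D f (f i) (j mod n) =
      coloured_multiplicity D g (g (i mod n)) (j mod n)" for i j
    using g[of "i mod n"] g[of "j mod n"] assms(1)
    by (auto simp: coloured_multiplicity_def f_def less_2_cases_iff)
  show ?thesis
  proof (rule that[of f])
    show "f (i mod n) = f i" for i
      by (simp add: f_def)
    show "coloured_multiplicity D f (f (i + 1)) (i mod n) \<noteq>
        coloured_multiplicity D f (f (i + 1)) ((i + 2) mod n)" for i
      using *[of "i mod n"] assms(1) by (simp add: eq mod_simps)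
  qed
qed

text \<open>Each step of two flips the colour, so \<open>k\<close> steps preserve it exactly for
  even \<open>k\<close>. The bounds \<open>a\<close> and \<open>b\<close> confine the walk to a
  stretch where flipping is known.\<close>

lemma alternating_steps:
  fixes f :: "nat \<Rightarrow> bool"
  assumes "\<And>j. a \<le> j \<Longrightarrow> j + 2 \<le> b \<Longrightarrow> f (j + 2) \<noteq> f j"
    and "a \<le> i" "i + 2 * k \<le> b"
  shows "f (i + 2 * k) \<longleftrightarrow> f i = even k"
  using assms(3)
proof (induction k)
  case (Suc k)
  have "f (i + 2 * k + 2) \<noteq> f (i + 2 * k)"
    using assms(1)[of "i + 2 * k"] assms(2) Suc.prems by simp
  then show ?case
    using Suc by (auto simp: algebra_simps)
qed simp

text \<open>The form \<open>D \<subseteq> {d}\<close> treats no doubled edge and one doubled edge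
  together; in the former case \<open>d\<close> is arbitrary.\<close>

lemma cycle_colouring_lower_bound:
  assumes n: "n \<ge> 4" and D: "D \<subseteq> {d}" "d < n"
    and c: "lir_2_colouring (double_edges (cycle_graph n) D) c"
  shows "n mod 4 = 0 \<or> n mod 4 = 1 \<and> D \<noteq> {}"
proof -
  obtain f :: "nat \<Rightarrow> bool" where per: "\<And>i. f (i mod n) = f i"
    and f: "\<And>i. coloured_multiplicity D f (f (i + 1)) (i mod n) \<noteq>
      coloured_multiplicity D f (f (i + 1)) ((i + 2) mod n)"
  proof (rule cycle_colouring_unrolled[of n D c])
    show "n \<ge> 2" "D \<subseteq> {..<n}"
      using assms by auto
  qed (use c in auto)
  \<comment> \<open>Rotate the cycle so that \<open>d\<close> sits at position 0.\<close>
  define h where "h i = f (d + i)" for i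
  have per': "h (i + n) = h i" for i
    by (metis h_def add.assoc mod_add_self2 per)
  have cond: "(if h i = h (i + 1) then multiplicity D ((d + i) mod n) else 0) \<noteq>
      (if h (i + 2) = h (i + 1) then multiplicity D ((d + (i + 2)) mod n) else 0)" for i
    using f[of "d + i"] 
      by (simp only: coloured_multiplicity_def per h_def add.assoc not_False_eq_True)
  \<comment> \<open>If both neighbours had the other colour, both would count 0.\<close>
  have some: "h (i + 1) = h i \<or> h (i + 1) = h (i + 2)" for i
    using cond[of i] by (auto split: if_splits)
  have alt: "h (i + 2) \<noteq> h i" if "(d + i) mod n \<notin> D" "(d + (i + 2)) mod n \<notin> D" for i
  proof
    assume "h (i + 2) = h i"
    then show False
      using cond[of i] that by (simp only: multiplicity_def if_False)
  qed
  \<comment> \<open>Only multiples of \<open>n\<close> hit \<open>d\<close>. The range extends past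
    \<open>n\<close> because \<open>close\<close> needs position \<open>n + 1\<close>.\<close>
  have off: "(d + i) mod n \<notin> D" if "0 < i" "i < n \<or> n < i \<and> i < 2 * n" for i
  proof
    assume "(d + i) mod n \<in> D"
    then have "(d + i) mod n = d mod n"
      using D by auto
    then have "n dvd i"
      using mod_eq_dvd_iff_nat[of d "d + i" n] by simp
    then show False
      using that by (metis dvd_minus_self dvd_imp_le less_diff_conv2 less_imp_le_nat mult_2 not_le
          zero_less_diff)
  qed
  have step: "h (j + 2) \<noteq> h j" if "1 \<le> j" "j + 2 \<le> n - 1" for j
  proof (rule alt)
    show "(d + j) mod n \<notin> D" "(d + (j + 2)) mod n \<notin> D"
      using that by (intro off; linarith)+
  qed
  \<comment> \<open>A step of two from \<open>n - 1\<close> jumps over position 0 and lands on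
    position 1 again.\<close>
  have close: "h 1 \<noteq> h (n - 1)"
  proof -
    have "n - 1 + 2 = n + 1"
      using n by simp
    then show ?thesis
      using alt[of "n - 1"] off[of "n - 1"] off[of "n + 1"] per'[of 1] n
      by (simp add: add.commute)
  qed
  have h: "h (i + 2 * k) \<longleftrightarrow> h i = even k" if "1 \<le> i" "i + 2 * k \<le> n - 1" for i k
    using alternating_steps[of 1 "n - 1" h] step that by simp
  have s1: "h 1 = h 0 \<or> h 1 = h 2"
    using some[of 0] by (simp only: add_0)
  have s2: "h (n - 1) = h (n - 2) \<or> h (n - 1) = h 0"
  proof -
    have "n - 2 + 2 = 0 + n" "n - 2 + 1 = n - 1"
      using n by simp_all
    then show ?thesis
      using some[of "n - 2"] per'[of 0] by (simp only: simp_thms)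
  qed
  show ?thesis
  proof (cases "even n")
    case True
    then obtain q where q: "n = 2 * q" by blast
    \<comment> \<open>The walk 1, 3, ..., \<open>n - 1\<close> makes \<open>q - 1\<close> flips, an
      odd number by \<open>close\<close>.\<close>
    have "n - 1 = 1 + 2 * (q - 1)"
      using q n by linarith
    then have "h (n - 1) \<longleftrightarrow> h 1 = even (q - 1)"
      using h[of 1 "q - 1"] by (simp only: order_refl)
    then have "even q"
      using close n q by auto
    then show ?thesis
      using q by auto
  next
    case False
    then obtain q where q: "n = 2 * q + 1" by (blast elim: oddE)
    \<comment> \<open>For odd \<open>n\<close> there are two walks, from 1 to \<open>n - 2\<close>
      and from 2 to \<open>n - 1\<close>, with \<open>q - 1\<close> flips each.\<close>
    have ends: "n - 2 = 1 + 2 * (q - 1)" "n - 1 = 2 + 2 * (q - 1)"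
      and q': "even (q - 1) \<longleftrightarrow> odd q"
      using q n by (linarith, linarith, simp)
    have h1: "h (n - 2) \<longleftrightarrow> h 1 = odd q"
      unfolding ends q'[symmetric] by (rule h) (use ends in linarith)+
    have h2: "h (n - 1) \<longleftrightarrow> h 2 = odd q"
      unfolding ends q'[symmetric] by (rule h) (use ends in linarith)+
    \<comment> \<open>If \<open>q\<close> were odd, both walks would preserve the colour. Then
      \<open>close\<close> gives \<open>h 1 \<noteq> h 2\<close> and
      \<open>h (n - 1) \<noteq> h (n - 2)\<close>, so by \<open>s1\<close> and \<open>s2\<close>
      both \<open>h 1\<close> and \<open>h (n - 1)\<close> equal \<open>h 0\<close>, against
      \<open>close\<close>.\<close>
    have "even q"
      using h1 h2 s1 s2 close by argo
    \<comment> \<open>Without a doubled edge, \<open>h 0\<close> differs from both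
      \<open>h 2\<close> and \<open>h (n - 2)\<close>. But for even \<open>q\<close>,
      \<open>h 2 = h 1\<close> and \<open>h (n - 2) \<noteq> h 1\<close>, and there are only two
      colours.\<close>
    moreover have "D \<noteq> {}"
    proof
      assume "D = {}"
      moreover have "n - 2 + 2 = 0 + n"
        using n by simp
      ultimately have "h 2 \<noteq> h 0" "h 0 \<noteq> h (n - 2)"
        using alt[of 0] alt[of "n - 2"] per'[of 0]
        by (simp_all only: add_0 empty_iff not_False_eq_True True_implies_equals)
      then show False
        using h1 h2 s1 close \<open>even q\<close> by argo
    qed
    ultimately show ?thesis
      using q by auto
  qed
qed

theorem mainTheorem2:
  fixes n :: nat
  assumes "n \<ge> 4"
  shows "(n mod 4 = 0 \<longrightarrow> D_lir (cycle_graph n) = 0) \<and>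
         (n mod 4 = 1 \<longrightarrow> D_lir (cycle_graph n) = 1) \<and>
         (n mod 4 = 2 \<or> n mod 4 = 3 \<longrightarrow> D_lir (cycle_graph n) = 2)"
proof -
  \<comment> \<open>One formula for the three cases; it is also the number of edges doubled in the
    construction.\<close>
  let ?r = "min (n mod 4) 2"
  have "D_lir (cycle_graph n) \<le> ?r"
  proof -
    define D where "D = {4 * (n div 4)..<min n (4 * (n div 4) + 2)}"
    have "card D = ?r"
      unfolding D_def card_atLeastLessThan by presburger
    moreover have "D \<subseteq> edges (cycle_graph n)"
      by (auto simp: D_def cycle_graph_def)
    moreover have "\<exists>c. lir_2_colouring (double_edges (cycle_graph n) D) c"
      using cycle_colouring_exists[OF assms] by (simp add: D_def)
    ultimately show ?thesis
      unfolding D_lir_def by (intro Inf_lower CollectI exI[of _ D] conjI) simp_all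
  qed
  moreover have "?r \<le> D_lir (cycle_graph n)"
    unfolding D_lir_def
  proof (rule Inf_greatest, safe)
    fix D c
    assume D: "D \<subseteq> edges (cycle_graph n)"
      and c: "lir_2_colouring (double_edges (cycle_graph n) D) c"
    have Dn: "D \<subseteq> {..<n}" "finite D"
      using D finite_subset by (auto simp: cycle_graph_def)
    \<comment> \<open>As \<open>?r\<close> is at most 2, a smaller \<open>D\<close> has at most one
      edge; if it is empty, edge 0 serves as \<open>d\<close>.\<close>
    have "?r \<le> card D"
    proof (rule ccontr)
      assume less: "\<not> ?r \<le> card D"
      then consider "card D = 0" | "card D = 1"
        by linarith
      then obtain d where d: "D \<subseteq> {d}" "d < n"
      proof cases
        case 1
        then show ?thesis
          using Dn assms by (intro that[of 0]) simp_all
      next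
        case 2
        then obtain d where "D = {d}"
          by (auto simp: card_1_singleton_iff)
        then show ?thesis
          using Dn by (intro that[of d]) simp_all
      qed
      have "n mod 4 = 0 \<or> n mod 4 = 1 \<and> card D > 0"
        using cycle_colouring_lower_bound[OF assms d c] Dn by (auto simp: card_gt_0_iff)
      then show False
        using less by auto
    qed
    then show "enat ?r \<le> enat (card D)" by simp
  qed
  ultimately have eq: "D_lir (cycle_graph n) = enat ?r"
    by simp
  show ?thesis
    by (auto simp: eq zero_enat_def one_enat_def numeral_eq_enat)
qed

end
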